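(* Let $q=p^e$ be a prime power, let $G$ be a group, and suppose that the surjective group homomorphism $\gamma: F(\mathcal{R}[t,t^{-1}])\to G$ sends $\mathcal{R}$ into $S$. Then $G$ (the image of $\gamma$) is solvable.
   Context: Rings. $\mathcal{R}=\mathbb{Z}[x,x^{-1},y,y^{-1}]$ is the two-variable integral Laurent polynomial ring and $\mathcal{R}[t,t^{-1}]$ the three-variable one. A positive unit of $\mathcal{R}$ is a monomial $x^a y^b$ with $a,b\in\mathbb{Z}$. $\Sigma$ is the augmentation ideal of $\mathcal{R}$ (the kernel of the ring map $\mathcal{R}\to\mathbb{Z}$, $x,y\mapsto 1$). $\mathcal{I}(q)$ is the $q$-cyclotomic ideal, generated by all elements $1+u+u^2+\cdots+u^{q-1}$ with $u$ a positive unit of $\mathcal{R}$. $S=\mathcal{R}/\mathcal{I}(q)\Sigma$. Groups. Let $$M_1=\begin{pmatrix}1&1-y\\0&x\end{pmatrix},\quad M_2=\begin{pmatrix}y&0\\1-x&1\end{pmatrix},\quad T=\begin{pmatrix}t&0\\1-t&1\end{pmatrix}.$$ $F(\mathcal{R}[t,t^{-1}])$ is the group generated by $M_1,\,M_2T$ (it is free of rank 2). Sending $\mathcal{R}$ into $S$. "$\gamma$ sends $\mathcal{R}$ into $S$" means: there is an ideal $J$ of $\mathcal{R}[t,t^{-1}]$ containing $\mathcal{I}(q)\Sigma$ such that, up to an isomorphism of $G$ with the image of $F(\mathcal{R}[t,t^{-1}])$ in $GL_2(\mathcal{R}[t,t^{-1}]/J)$, the map $\gamma$ is entrywise reduction modulo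 $J$ (so that $\mathcal{R}\to\mathcal{R}[t,t^{-1}]/J$ factors through $\mathcal{R}\to S$). *)

theory Defs
  imports
    "HOL-Library.Poly_Mapping"
    "HOL-Library.Product_Plus"
    "HOL-Algebra.IntRing"
    "HOL-Algebra.QuotRing"
    "HOL-Algebra.Ideal_Product"
    "HOL-Algebra.Elementary_Groups"
    "HOL-Algebra.Solvable_Groups"
    "HOL-Algebra.Algebraic_Closure_Type"
    "HOL-Analysis.Cartesian_Space"
begin

text \<open>
  Finitely supported functions with the convolution product: the coefficient of
  \<open>x\<^sup>a y\<^sup>b\<close> is the value at \<open>(a, b)\<close>, and Laurent polynomials in \<open>t\<close> have
  coefficients in the two-variable ring.
\<close>

type_synonym laurent_xy = "(int \<times> int) \<Rightarrow>\<^sub>0 int"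
type_synonym laurent_xyt = "int \<Rightarrow>\<^sub>0 laurent_xy"

abbreviation R_xy :: "laurent_xy ring" where
  "R_xy \<equiv> ring_of_type_algebra"

abbreviation R_xyt :: "laurent_xyt ring" where
  "R_xyt \<equiv> ring_of_type_algebra"

definition pos_unit :: "int \<Rightarrow> int \<Rightarrow> laurent_xy" where
  "pos_unit a b = Poly_Mapping.single (a, b) 1"

definition const_t :: "laurent_xy \<Rightarrow> laurent_xyt" where
  "const_t f = Poly_Mapping.single 0 f"

definition var_x :: laurent_xyt where
  "var_x = const_t (pos_unit 1 0)"

definition var_y :: laurent_xyt where
  "var_y = const_t (pos_unit 0 1)"

definition var_t :: laurent_xyt where
  "var_t = Poly_Mapping.single 1 1"

text \<open>Evaluation at \<open>x = y = 1\<close> is the sum of the coefficients.\<close>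

definition augmentation :: "laurent_xy \<Rightarrow> int" where
  "augmentation f = (\<Sum>m\<in>Poly_Mapping.keys f. Poly_Mapping.lookup f m)"

definition augmentation_ideal :: "laurent_xy set" where
  "augmentation_ideal = a_kernel R_xy \<Z> augmentation"

definition cyclotomic_ideal :: "nat \<Rightarrow> laurent_xy set" where
  "cyclotomic_ideal q = Idl\<^bsub>R_xy\<^esub> {\<Sum>i<q. pos_unit a b ^ i | a b. True}"

definition mat2_monoid :: "('r, 'm) ring_scheme \<Rightarrow> ('r^2^2) monoid" where
  "mat2_monoid R =
    \<lparr> carrier = {A. \<forall>i j. A $ i $ j \<in> carrier R},
      mult = (\<lambda>A B. \<chi> i j. \<Oplus>\<^bsub>R\<^esub>k\<in>UNIV. A $ i $ k \<otimes>\<^bsub>R\<^esub> B $ k $ j),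
      one = (\<chi> i j. if i = j then \<one>\<^bsub>R\<^esub> else \<zero>\<^bsub>R\<^esub>) \<rparr>"

definition GL2 :: "('r, 'm) ring_scheme \<Rightarrow> ('r^2^2) monoid" where
  "GL2 R = units_of (mat2_monoid R)"

definition M1 :: "laurent_xyt^2^2" where
  "M1 = vector [vector [1, 1 - var_y],
                vector [0, var_x]]"

definition M2 :: "laurent_xyt^2^2" where
  "M2 = vector [vector [var_y, 0],
                vector [1 - var_x, 1]]"

definition T_mat :: "laurent_xyt^2^2" where
  "T_mat = vector [vector [var_t, 0],
                   vector [1 - var_t, 1]]"

text \<open>
  \<open>subgroup_generated\<close> discards generators outside the group; none is lost here, by
  \<open>generators_in_GL2\<close> below.
\<close>

definition F_group :: "(laurent_xyt^2^2) monoid" where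
  "F_group = subgroup_generated (GL2 R_xyt) {M1, M2 ** T_mat}"

definition reduce_mod :: "laurent_xyt set \<Rightarrow> laurent_xyt^2^2 \<Rightarrow> laurent_xyt set^2^2" where
  "reduce_mod J A = (\<chi> i j. J +>\<^bsub>R_xyt\<^esub> (A $ i $ j))"

text \<open>
  \<open>S\<close> is the quotient of the two-variable ring by \<open>cyclotomic_ideal q \<cdot> augmentation_ideal\<close>. The
  inclusion into \<open>J\<close> below is what makes the map from the two-variable ring to
  \<open>R_xyt Quot J\<close> factor through \<open>S\<close>.
\<close>

definition sends_R_into_S ::
    "nat \<Rightarrow> ('g, 'm) monoid_scheme \<Rightarrow> (laurent_xyt^2^2 \<Rightarrow> 'g) \<Rightarrow> bool" where
  "sends_R_into_S q G \<gamma> \<longleftrightarrow>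
    (\<exists>J \<phi>. ideal J R_xyt \<and>
      const_t ` (cyclotomic_ideal q \<cdot>\<^bsub>R_xy\<^esub> augmentation_ideal) \<subseteq> J \<and>
      \<phi> \<in> iso G ((GL2 (R_xyt Quot J)) \<lparr> carrier := reduce_mod J ` carrier F_group \<rparr>) \<and>
      (\<forall>A \<in> carrier F_group. \<phi> (\<gamma> A) = reduce_mod J A))"

lemma augmentation_single: "augmentation (Poly_Mapping.single m c) = c"
  by (simp add: augmentation_def)

lemma augmentation_superset:
  assumes "finite A" "Poly_Mapping.keys f \<subseteq> A"
  shows "augmentation f = (\<Sum>m\<in>A. Poly_Mapping.lookup f m)"
  unfolding augmentation_def using assms
  by (intro sum.mono_neutral_left) (auto simp: in_keys_iff)

lemma augmentation_add: "augmentation (f + g) = augmentation f + augmentation g"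
proof -
  have "Poly_Mapping.keys (f + g) \<subseteq> Poly_Mapping.keys f \<union> Poly_Mapping.keys g" by (rule Poly_Mapping.keys_add)
  then show ?thesis
    by (simp add: augmentation_superset[of "Poly_Mapping.keys f \<union> Poly_Mapping.keys g"] lookup_add sum.distrib)
qed

lemma single_sum_induct [case_names single sum]:
  fixes f :: "'a \<Rightarrow>\<^sub>0 'b :: comm_monoid_add"
  assumes single: "\<And>m c. P (Poly_Mapping.single m c)"
    and sum: "\<And>f g. P f \<Longrightarrow> P g \<Longrightarrow> P (f + g)"
  shows "P f"
proof (induction f rule: update_induct)
  case const
  show ?case using single[of undefined 0] by simp
next
  case (update f a b)
  have "Poly_Mapping.update a b f = f + Poly_Mapping.single a b"
    using update by (intro poly_mapping_eqI)
      (auto simp: lookup_update lookup_add lookup_single when_def in_keys_iff)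
  then show ?case using update single sum by simp
qed

lemma augmentation_mult: "augmentation (f * g) = augmentation f * augmentation g"
proof (induction f rule: single_sum_induct)
  case (single m c)
  show ?case
  proof (induction g rule: single_sum_induct)
    case (single n d)
    show ?case by (simp add: mult_single augmentation_single)
  next
    case (sum g1 g2)
    then show ?case by (simp add: algebra_simps augmentation_add)
  qed
next
  case (sum f1 f2)
  then show ?case by (simp add: algebra_simps augmentation_add)
qed

lemma augmentation_ring_hom: "augmentation \<in> ring_hom R_xy \<Z>"
  by (auto simp: ring_hom_def ring_of_type_algebra_def augmentation_add augmentation_mult
      augmentation_single simp flip: single_one)

lemma augmentation_pos_unit: "augmentation (pos_unit a b) = 1"
  by (simp add: pos_unit_def augmentation_single)

lemma finsum_ring_of_type_algebra:
  fixes f :: "2 \<Rightarrow> 'a :: comm_ring_1"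
  shows "(\<Oplus>\<^bsub>ring_of_type_algebra\<^esub>k\<in>UNIV. f k) = (\<Sum>k\<in>UNIV. f k)"
proof -
  interpret cring "ring_of_type_algebra :: 'a ring"
    by (rule cring_from_type_algebra)
  have "f k \<in> carrier ring_of_type_algebra" for k
    by (simp add: ring_of_type_algebra_def)
  then have "(\<Oplus>\<^bsub>ring_of_type_algebra\<^esub>k\<in>UNIV. f k) = f 1 \<oplus>\<^bsub>ring_of_type_algebra\<^esub> f 2"
    unfolding UNIV_2 by (simp add: finsum_insert)
  then show ?thesis
    by (simp only: sum_2) (simp add: ring_of_type_algebra_def)
qed

lemma mult_mat2_monoid_type:
  "A \<otimes>\<^bsub>mat2_monoid ring_of_type_algebra\<^esub> B = A ** (B :: ('a :: comm_ring_1)^2^2)"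
proof -
  have "x \<otimes>\<^bsub>ring_of_type_algebra\<^esub> y = x * y" for x y :: 'a
    by (simp add: ring_of_type_algebra_def)
  then show ?thesis
    by (simp add: mat2_monoid_def matrix_matrix_mult_def finsum_ring_of_type_algebra)
qed

lemma one_mat2_monoid_type:
  "\<one>\<^bsub>mat2_monoid ring_of_type_algebra\<^esub> = (mat 1 :: ('a :: comm_ring_1)^2^2)"
  by (simp add: mat2_monoid_def mat_def vec_eq_iff) (simp add: ring_of_type_algebra_def)

lemma GL2_typeI:
  fixes A B :: "('a :: comm_ring_1)^2^2"
  assumes "A ** B = mat 1" "B ** A = mat 1"
  shows "A \<in> carrier (GL2 ring_of_type_algebra)"
proof -
  have "C \<in> carrier (mat2_monoid ring_of_type_algebra)" for C :: "'a^2^2"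
    by (simp add: mat2_monoid_def ring_of_type_algebra_def)
  then show ?thesis
    using assms unfolding GL2_def units_of_def Units_def
    by (auto simp: mult_mat2_monoid_type one_mat2_monoid_type)
qed

lemma unit_exists:
  "\<exists>u. var_x * u = 1" "\<exists>u. var_y * u = 1" "\<exists>u. var_t * u = 1"
proof -
  have "var_x * const_t (pos_unit (-1) 0) = 1" "var_y * const_t (pos_unit 0 (-1)) = 1"
    "var_t * Poly_Mapping.single (-1) 1 = 1"
    by (simp_all add: var_x_def var_y_def var_t_def const_t_def pos_unit_def mult_single
        flip: zero_prod_def)
  then show "\<exists>u. var_x * u = 1" "\<exists>u. var_y * u = 1" "\<exists>u. var_t * u = 1" by blast+
qed

lemma generators_in_GL2:
  "M1 \<in> carrier (GL2 R_xyt)" "M2 ** T_mat \<in> carrier (GL2 R_xyt)"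
proof -
  obtain u v w where u: "var_x * u = 1" and v: "var_y * v = 1" and w: "var_t * w = 1"
    using unit_exists by blast
  have u': "u * var_x = 1" and v': "v * var_y = 1" and w': "w * var_t = 1"
    using u v w by (simp_all add: mult.commute)
  define N1 :: "laurent_xyt^2^2" where
    "N1 = vector [vector [1, - ((1 - var_y) * u)], vector [0, u]]"
  define N2 :: "laurent_xyt^2^2" where
    "N2 = vector [vector [v, 0], vector [- ((1 - var_x) * v), 1]]"
  define N3 :: "laurent_xyt^2^2" where
    "N3 = vector [vector [w, 0], vector [- ((1 - var_t) * w), 1]]"
  have 1: "M1 ** N1 = mat 1" "N1 ** M1 = mat 1"
    by (simp_all add: M1_def N1_def vec_eq_iff forall_2 matrix_matrix_mult_def mat_def sum_2
        u u' mult.assoc)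
  have 2: "M2 ** N2 = mat 1" "N2 ** M2 = mat 1"
    by (simp_all add: M2_def N2_def vec_eq_iff forall_2 matrix_matrix_mult_def mat_def sum_2
        v v' mult.assoc)
  have 3: "T_mat ** N3 = mat 1" "N3 ** T_mat = mat 1"
    by (simp_all add: T_mat_def N3_def vec_eq_iff forall_2 matrix_matrix_mult_def mat_def sum_2
        w w' mult.assoc)
  show "M1 \<in> carrier (GL2 R_xyt)" using 1 by (rule GL2_typeI)
  have "(M2 ** T_mat) ** (N3 ** N2) = M2 ** (T_mat ** N3) ** N2"
    by (simp add: matrix_mul_assoc)
  moreover have "(N3 ** N2) ** (M2 ** T_mat) = N3 ** (N2 ** M2) ** T_mat"
    by (simp add: matrix_mul_assoc)
  ultimately show "M2 ** T_mat \<in> carrier (GL2 R_xyt)"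
    using 2 3 by (intro GL2_typeI[of _ "N3 ** N2"]) simp_all
qed

end

theory Submission
  imports Defs
begin

text \<open>
  Write \<open>a = x - 1\<close> and \<open>b = y - 1\<close>. Taking \<open>u = 1\<close> shows that \<open>q = p\<^sup>e\<close> lies in the cyclotomic
  ideal, and modulo \<open>p\<close> one has \<open>a\<^sup>q = x\<^sup>q - 1\<close>, a multiple of \<open>1 + x + \<dots> + x\<^bsup>q-1\<^esup>\<close>; hence \<open>a\<close>, and
  likewise \<open>b\<close>, is nilpotent modulo \<open>J\<close>, and so some power of the ideal \<open>(a, b)\<close> lies in \<open>J\<close>.
  Modulo \<open>(a, b)\<close> the matrix \<open>M\<^sub>1\<close> is the identity, so the group is commutative there. The
  commutator of two matrices congruent to \<open>1\<close> modulo \<open>(a, b)\<^sup>n\<close> is congruent to \<open>1\<close> modulo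
  \<open>(a, b)\<^bsup>2n\<^esup>\<close>, so the derived series becomes trivial modulo \<open>J\<close>.
\<close>

section \<open>Powers of a two-generated ideal\<close>

text \<open>This is the \<open>n\<close>-th power of the ideal \<open>(a, b)\<close>. Adding one
  multiple of a monomial at a time yields an induction rule from which the closure properties
  follow.\<close>

inductive_set pow_ideal :: "'a::comm_ring_1 \<Rightarrow> 'a \<Rightarrow> nat \<Rightarrow> 'a set"
  for a b n where
    zero: "0 \<in> pow_ideal a b n"
  | step: "n \<le> i + j \<Longrightarrow> f \<in> pow_ideal a b n \<Longrightarrow> c * a ^ i * b ^ j + f \<in> pow_ideal a b n"

lemma pow_ideal_monomial: "n \<le> i + j \<Longrightarrow> c * a ^ i * b ^ j \<in> pow_ideal a b n"
  using pow_ideal.step[OF _ pow_ideal.zero] by fastforce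

lemma pow_ideal_gens: "c * a \<in> pow_ideal a b 1" "c * b \<in> pow_ideal a b 1"
  using pow_ideal_monomial[of 1 1 0 c a b] pow_ideal_monomial[of 1 0 1 c a b] by auto

lemma pow_ideal_add:
  assumes "f \<in> pow_ideal a b n" "g \<in> pow_ideal a b n"
  shows "f + g \<in> pow_ideal a b n"
  using assms by (induction f) (auto simp: add.assoc intro: pow_ideal.step)

lemma pow_ideal_mult:
  assumes "f \<in> pow_ideal a b n"
  shows "r * f \<in> pow_ideal a b n"
  using assms
proof induction
  case (step i j f c)
  then show ?case
    using pow_ideal.step[of n i j "r * f" a b "r * c"] by (simp add: algebra_simps)
qed (auto intro: pow_ideal.zero)

lemma pow_ideal_mult':
  assumes "f \<in> pow_ideal a b n"
  shows "f * r \<in> pow_ideal a b n"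
  using pow_ideal_mult[OF assms, of r] by (simp add: mult.commute)

lemma pow_ideal_minus: "f \<in> pow_ideal a b n \<Longrightarrow> - f \<in> pow_ideal a b n"
  using pow_ideal_mult[of f a b n "-1"] by simp

lemma pow_ideal_diff:
  "f \<in> pow_ideal a b n \<Longrightarrow> g \<in> pow_ideal a b n \<Longrightarrow> f - g \<in> pow_ideal a b n"
  using pow_ideal_add[of f a b n "- g"] pow_ideal_minus[of g] by simp

text \<open>Degrees of monomials add up. This is the inner half of a double induction;
  \<open>pow_ideal_prod\<close> runs the outer one over the other factor.\<close>

lemma pow_ideal_monomial_prod:
  assumes "g \<in> pow_ideal a b n" "m \<le> i + j"
  shows "c * a ^ i * b ^ j * g \<in> pow_ideal a b (m + n)"
  using assms(1)
proof induction
  case (step k l g d)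
  then show ?case
    using pow_ideal.step[of "m + n" "i + k" "j + l" "c * a ^ i * b ^ j * g" a b "c * d"] assms(2)
    by (simp add: algebra_simps power_add)
qed (auto intro: pow_ideal.zero)

lemma pow_ideal_prod:
  assumes "f \<in> pow_ideal a b m" "g \<in> pow_ideal a b n"
  shows "f * g \<in> pow_ideal a b (m + n)"
  using assms(1)
proof induction
  case (step i j f c)
  then show ?case
    using pow_ideal_add[OF pow_ideal_monomial_prod[OF assms(2), of m i j c]]
    by (simp add: distrib_right)
qed (auto intro: pow_ideal.zero)

lemma pow_ideal_antimono:
  assumes "m \<le> n"
  shows "pow_ideal a b n \<subseteq> pow_ideal a b m"
proof
  fix f assume "f \<in> pow_ideal a b n"
  then show "f \<in> pow_ideal a b m"
    using assms by induction (auto intro: pow_ideal.intros)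
qed

lemma power_mult_mono_mem:
  fixes J :: "'a::comm_ring_1 set"
  assumes "\<And>r f. f \<in> J \<Longrightarrow> r * f \<in> J" "a ^ N \<in> J" "N \<le> i"
  shows "c * a ^ i \<in> J"
  using assms(1)[OF assms(2), of "c * a ^ (i - N)"] assms(3)
  by (simp add: mult.assoc flip: power_add)

text \<open>Pigeonhole: \<open>i + j \<ge> 2 * N\<close> forces \<open>N \<le> i\<close> or
  \<open>N \<le> j\<close>, so each generating monomial is divisible by \<open>a ^ N\<close> or by
  \<open>b ^ N\<close>.\<close>

lemma pow_ideal_subset:
  fixes J :: "'a::comm_ring_1 set"
  assumes J: "0 \<in> J" "\<And>f g. f \<in> J \<Longrightarrow> g \<in> J \<Longrightarrow> f + g \<in> J" "\<And>r f. f \<in> J \<Longrightarrow> r * f \<in> J"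
    and a: "a ^ N \<in> J" and b: "b ^ N \<in> J"
  shows "pow_ideal a b (2 * N) \<subseteq> J"
proof
  fix f assume "f \<in> pow_ideal a b (2 * N)"
  then show "f \<in> J"
  proof induction
    case (step i j f c)
    consider "N \<le> i" | "N \<le> j" using step.hyps by linarith
    then have "c * a ^ i * b ^ j \<in> J"
    proof cases
      case 1
      then show ?thesis
        using power_mult_mono_mem[OF J(3) a, of i "c * b ^ j"] by (simp add: algebra_simps)
    next
      case 2
      then show ?thesis
        using power_mult_mono_mem[OF J(3) b, of j "c * a ^ i"] by simp
    qed
    then show ?case using step J(2) by blast
  qed (rule J(1))
qed

section \<open>Nilpotency of the augmentation ideal\<close>

text \<open>The inner binomial coefficients are divisible by \<open>p\<close>. The ring need not
  have characteristic \<open>p\<close>, so the error is kept as an explicit multiple of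
  \<open>p\<close>.\<close>

lemma prime_power_binomial:
  fixes a b :: "'a::comm_ring_1"
  assumes "Factorial_Ring.prime p"
  shows "\<exists>g. (a + b) ^ p = a ^ p + b ^ p + of_nat p * g"
proof -
  have p: "p > 0" using assms prime_gt_0_nat by blast
  have "\<exists>d. of_nat (p choose k) * a ^ k * b ^ (p - k) = of_nat p * d" if "k \<in> {..p} - {0, p}" for k
  proof -
    have "p dvd (p choose k)"
      using that assms by (intro dvd_choose_prime) auto
    then show ?thesis
      by (auto simp: dvd_def mult.assoc)
  qed
  then obtain d where
    d: "\<And>k. k \<in> {..p} - {0, p} \<Longrightarrow> of_nat (p choose k) * a ^ k * b ^ (p - k) = of_nat p * d k"
    by metis
  have "(a + b) ^ p = (\<Sum>k\<in>{..p}. of_nat (p choose k) * a ^ k * b ^ (p - k))"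
    by (rule binomial_ring)
  also have "\<dots> = (\<Sum>k\<in>{..p} - {0, p}. of_nat (p choose k) * a ^ k * b ^ (p - k))
      + (\<Sum>k\<in>{0, p}. of_nat (p choose k) * a ^ k * b ^ (p - k))"
    by (rule sum.subset_diff) auto
  also have "\<dots> = of_nat p * (\<Sum>k\<in>{..p} - {0, p}. d k) + (a ^ p + b ^ p)"
    using p by (simp add: d sum_distrib_left)
  finally show ?thesis by (metis add.commute)
qed

lemma prime_power_power_binomial:
  fixes a b :: "'a::comm_ring_1"
  assumes "Factorial_Ring.prime p"
  shows "\<exists>g. (a + b) ^ (p ^ e) = a ^ (p ^ e) + b ^ (p ^ e) + of_nat p * g"
proof (induction e)
  case 0
  show ?case by (auto intro: exI[of _ 0])
next
  case (Suc e)
  define A B where "A = a ^ (p ^ e)" and "B = b ^ (p ^ e)"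
  obtain g where g: "(a + b) ^ (p ^ e) = A + B + of_nat p * g"
    using Suc unfolding A_def B_def by blast
  obtain h where h: "(A + B + of_nat p * g) ^ p = (A + B) ^ p + (of_nat p * g) ^ p + of_nat p * h"
    using prime_power_binomial[OF assms] by blast
  obtain k where k: "(A + B) ^ p = A ^ p + B ^ p + of_nat p * k"
    using prime_power_binomial[OF assms] by blast
  have "p > 0" using assms prime_gt_0_nat by blast
  \<comment> \<open>The \<open>p\<close>-th power of the old error term has to be absorbed into the
    new one, so one factor \<open>p\<close> is split off.\<close>
  then have gp: "(of_nat p * g) ^ p = of_nat p * (g * (of_nat p * g) ^ (p - 1))"
    by (metis mult.assoc power_eq_if not_gr_zero)
  have "(A + B + of_nat p * g) ^ p
      = A ^ p + B ^ p + of_nat p * (k + g * (of_nat p * g) ^ (p - 1) + h)"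
    unfolding h k gp by (simp only: distrib_left add.assoc)
  then have "(a + b) ^ (p ^ Suc e) = a ^ (p ^ Suc e) + b ^ (p ^ Suc e)
      + of_nat p * (k + g * (of_nat p * g) ^ (p - 1) + h)"
    unfolding A_def B_def g[symmetric, unfolded A_def B_def] power_Suc2 power_mult .
  then show ?case by blast
qed

lemma dvd_power_add_diff:
  fixes u w :: "'a::comm_ring_1"
  shows "u dvd (u + w) ^ n - w ^ n"
  by (metis add_diff_cancel_right' dvd_triv_left power_diff_sumr2)

text \<open>Modulo \<open>p\<close>, \<open>(x - 1) ^ q\<close> is \<open>x ^ q - 1\<close>, a
  multiple of the cyclotomic sum. Raising to the power \<open>e\<close> turns the error term, a
  multiple of \<open>p\<close>, into a multiple of \<open>p ^ e = q\<close> modulo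
  \<open>x ^ q - 1\<close>; hence the exponent \<open>q * e\<close>.\<close>

lemma diff_one_power_mem:
  fixes I :: "'a::comm_ring_1 set" and x :: 'a
  assumes p: "Factorial_Ring.prime p" and q: "q = p ^ e"
    and I: "\<And>f g. f \<in> I \<Longrightarrow> g \<in> I \<Longrightarrow> f + g \<in> I" "\<And>r f. f \<in> I \<Longrightarrow> r * f \<in> I"
    and "of_nat q \<in> I" and "(\<Sum>i<q. x ^ i) \<in> I"
  shows "(x - 1) ^ (q * e) \<in> I"
proof -
  \<comment> \<open>Expanding \<open>x\<close> as \<open>(x - 1) + 1\<close> instead of expanding
    \<open>x - 1\<close> avoids the sign of \<open>(-1) ^ q\<close>.\<close>
  obtain g where "((x - 1) + 1) ^ q = (x - 1) ^ q + 1 ^ q + of_nat p * g"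
    using prime_power_power_binomial[OF p] unfolding q by blast
  then have g: "(x - 1) ^ q = (x ^ q - 1) + of_nat p * (- g)"
    by (simp add: algebra_simps)
  have u: "x ^ q - 1 \<in> I"
    using I(2)[OF assms(6)] by (simp add: power_diff_1_eq)
  obtain k where "(x - 1) ^ (q * e) - (of_nat p * (- g)) ^ e = (x ^ q - 1) * k"
    using dvd_power_add_diff[of "x ^ q - 1" "of_nat p * (- g)" e]
    unfolding g[symmetric] power_mult[symmetric] dvd_def by blast
  then have "(x - 1) ^ (q * e) = k * (x ^ q - 1) + (- g) ^ e * of_nat q"
    by (simp only: q power_mult_distrib of_nat_power algebra_simps)
  then show ?thesis using I u assms(5) by simp
qed

section \<open>The ideals of the Laurent polynomial rings\<close>

lemma ring_of_type_algebra_sel: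
  "carrier ring_of_type_algebra = (UNIV :: 'a::comm_ring_1 set)"
  "x \<oplus>\<^bsub>ring_of_type_algebra\<^esub> y = x + (y::'a)"
  "x \<otimes>\<^bsub>ring_of_type_algebra\<^esub> y = x * (y::'a)"
  "\<zero>\<^bsub>ring_of_type_algebra\<^esub> = (0::'a)"
  "\<one>\<^bsub>ring_of_type_algebra\<^esub> = (1::'a)"
  by (simp_all add: ring_of_type_algebra_def)

text \<open>Translates the locale \<open>ideal\<close> into the closure properties that the
  preceding lemmas take as hypotheses.\<close>

lemma ideal_ring_of_type_algebraD:
  fixes I :: "'a::comm_ring_1 set"
  assumes "ideal I ring_of_type_algebra"
  shows "0 \<in> I" "\<And>f g. f \<in> I \<Longrightarrow> g \<in> I \<Longrightarrow> f + g \<in> I" "\<And>r f. f \<in> I \<Longrightarrow> r * f \<in> I"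
proof -
  interpret ideal I "ring_of_type_algebra :: 'a ring" by (rule assms)
  show "0 \<in> I" using additive_subgroup.zero_closed[OF is_additive_subgroup] by (simp add: ring_of_type_algebra_sel)
  show "f + g \<in> I" if "f \<in> I" "g \<in> I" for f g
    using additive_subgroup.a_closed[OF is_additive_subgroup that] by (simp add: ring_of_type_algebra_sel)
  show "r * f \<in> I" if "f \<in> I" for r f
    using I_l_closed[OF that, of r] by (simp add: ring_of_type_algebra_sel)
qed

lemma cyclotomic_ideal_ideal: "ideal (cyclotomic_ideal q) R_xy"
  unfolding cyclotomic_ideal_def
  by (intro ring.genideal_ideal ring_from_type_algebra) (simp add: ring_of_type_algebra_sel)

lemma cyclotomic_sum_mem: "(\<Sum>i<q. pos_unit a b ^ i) \<in> cyclotomic_ideal q"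
  unfolding cyclotomic_ideal_def
  by (intro subsetD[OF ring.genideal_self[OF ring_from_type_algebra]])
    (auto simp: ring_of_type_algebra_sel)

lemma pos_unit_0_0: "pos_unit 0 0 = 1"
  by (simp add: pos_unit_def flip: zero_prod_def)

lemma of_nat_mem_cyclotomic_ideal: "of_nat q \<in> cyclotomic_ideal q"
  using cyclotomic_sum_mem[of 0 0 q] by (simp add: pos_unit_0_0)

lemma pos_unit_diff_mem_augmentation_ideal: "pos_unit a b - 1 \<in> augmentation_ideal"
proof -
  have "augmentation (pos_unit a b - 1) + augmentation 1 = 1"
    by (simp add: augmentation_pos_unit flip: augmentation_add)
  moreover have "augmentation 1 = 1"
    by (metis augmentation_pos_unit pos_unit_0_0)
  ultimately show ?thesis
    by (simp add: augmentation_ideal_def a_kernel_def kernel_def ring_of_type_algebra_sel)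
qed

lemma const_t_diff: "const_t (f - g) = const_t f - const_t g"
  by (simp add: const_t_def single_diff)

lemma const_t_one: "const_t 1 = 1"
  by (simp add: const_t_def)

lemma const_t_mult: "const_t (f * g) = const_t f * const_t g"
  by (simp add: const_t_def mult_single)

lemma const_t_power: "const_t (f ^ n) = const_t f ^ n"
  by (induction n) (simp_all add: const_t_one const_t_mult)

text \<open>The first \<open>q * e\<close> factors give an element of the cyclotomic ideal, and the
  extra factor counted by \<open>Suc\<close> lies in the augmentation ideal, so the power lies in
  the product of the two ideals.\<close>

lemma pos_unit_diff_power_mem:
  assumes "Factorial_Ring.prime p" "q = p ^ e"
    and "const_t ` (cyclotomic_ideal q \<cdot>\<^bsub>R_xy\<^esub> augmentation_ideal) \<subseteq> J"
  shows "(const_t (pos_unit a b) - 1) ^ Suc (q * e) \<in> J"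
proof -
  have "(pos_unit a b - 1) ^ (q * e) \<in> cyclotomic_ideal q"
    using assms(1,2) ideal_ring_of_type_algebraD(2,3)[OF cyclotomic_ideal_ideal]
      of_nat_mem_cyclotomic_ideal cyclotomic_sum_mem
    by (rule diff_one_power_mem)
  from ideal_prod.prod[OF this pos_unit_diff_mem_augmentation_ideal, of R_xy]
  have "(pos_unit a b - 1) ^ Suc (q * e) \<in> cyclotomic_ideal q \<cdot>\<^bsub>R_xy\<^esub> augmentation_ideal"
    by (simp add: ring_of_type_algebra_sel mult.commute)
  then have "const_t ((pos_unit a b - 1) ^ Suc (q * e)) \<in> J"
    using assms(3) by blast
  then show ?thesis
    by (simp only: const_t_power const_t_diff const_t_one)
qed

section \<open>Congruences of matrices\<close>

definition mat_cong :: "'a::comm_ring_1 \<Rightarrow> 'a \<Rightarrow> nat \<Rightarrow> 'a^2^2 \<Rightarrow> 'a^2^2 \<Rightarrow> bool" where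
  "mat_cong a b n A B \<longleftrightarrow> (\<forall>i j. (A - B) $ i $ j \<in> pow_ideal a b n)"

lemma mat_cong_refl: "mat_cong a b n A A"
  by (simp add: mat_cong_def pow_ideal.zero)

lemma mat_cong_sym: "mat_cong a b n A B \<Longrightarrow> mat_cong a b n B A"
  unfolding mat_cong_def by (metis minus_diff_eq pow_ideal_minus vector_minus_component)

lemma mat_cong_trans:
  "mat_cong a b n A B \<Longrightarrow> mat_cong a b n B C \<Longrightarrow> mat_cong a b n A C"
  unfolding mat_cong_def
  using pow_ideal_add[of "(A - B) $ i $ j" a b n "(B - C) $ i $ j" for i j] by simp

lemma matrix_mult_2:
  "((A :: 'a::comm_ring_1^2^2) ** B) $ i $ j = A $ i $ 1 * B $ 1 $ j + A $ i $ 2 * B $ 2 $ j"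
  by (simp add: matrix_matrix_mult_def sum_2)

lemma mat_cong_mult_left:
  assumes "mat_cong a b n A B"
  shows "mat_cong a b n (C ** A) (C ** B)"
proof -
  have eq: "(C ** A - C ** B) $ i $ j
      = C $ i $ 1 * (A - B) $ 1 $ j + C $ i $ 2 * (A - B) $ 2 $ j" for i j
    by (simp add: matrix_mult_2 algebra_simps)
  then show ?thesis
    using assms unfolding mat_cong_def eq by (blast intro: pow_ideal_add pow_ideal_mult)
qed

lemma mat_cong_mult_right:
  assumes "mat_cong a b n A B"
  shows "mat_cong a b n (A ** C) (B ** C)"
proof -
  have eq: "(A ** C - B ** C) $ i $ j
      = (A - B) $ i $ 1 * C $ 1 $ j + (A - B) $ i $ 2 * C $ 2 $ j" for i j
    by (simp add: matrix_mult_2 algebra_simps)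
  then show ?thesis
    using assms unfolding mat_cong_def eq by (blast intro: pow_ideal_add pow_ideal_mult')
qed

text \<open>With \<open>A = 1 + U\<close> and \<open>B = 1 + V\<close> the linear terms cancel:
  \<open>AB - BA = UV - VU\<close>, and its entries are built from products of an entry of
  \<open>U\<close> and an entry of \<open>V\<close>.\<close>

lemma mat_cong_one_commute:
  assumes "mat_cong a b m A (mat 1)" "mat_cong a b n B (mat 1)"
  shows "mat_cong a b (m + n) (A ** B) (B ** A)"
proof -
  define U V where "U = A - mat 1" and "V = B - mat 1"
  have "(A ** B - B ** A) $ i $ j = (U ** V - V ** U) $ i $ j" for i j
    unfolding U_def V_def using exhaust_2[of i] exhaust_2[of j]
    by (auto simp: matrix_mult_2 mat_def algebra_simps)
  moreover have "U $ i $ j \<in> pow_ideal a b m" "V $ i $ j \<in> pow_ideal a b n" for i j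
    using assms by (auto simp: mat_cong_def U_def V_def)
  then have "(U ** V - V ** U) $ i $ j \<in> pow_ideal a b (m + n)" for i j
    unfolding vector_minus_component matrix_mult_2
    \<comment> \<open>The entries of \<open>V ** U\<close> come with exponent \<open>n + m\<close>,
      hence the second copy of the product rule with the sum commuted.\<close>
    by (intro pow_ideal_diff pow_ideal_add pow_ideal_prod
        pow_ideal_prod[of _ _ _ n _ m, unfolded add.commute[of n m]]) auto
  ultimately show ?thesis by (simp add: mat_cong_def)
qed

text \<open>Replacing \<open>AB\<close> by \<open>BA\<close> in the commutator leaves
  \<open>B A A' B'\<close>, which collapses to \<open>1\<close>.\<close>

lemma mat_cong_commutator:
  assumes "mat_cong a b n (A ** B) (B ** A)" "A ** A' = mat 1" "B ** B' = mat 1"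
  shows "mat_cong a b n (A ** B ** A' ** B') (mat 1)"
proof -
  have "B ** A ** A' ** B' = mat 1"
    using assms(2,3) by (simp add: matrix_mul_assoc[symmetric])
  then show ?thesis
    by (metis assms(1) mat_cong_mult_right)
qed

section \<open>The congruence filtration\<close>

lemma monoid_mat2: "Group.monoid (mat2_monoid (ring_of_type_algebra :: 'a::comm_ring_1 ring))"
proof -
  have "carrier (mat2_monoid (ring_of_type_algebra :: 'a ring)) = UNIV"
    by (simp add: mat2_monoid_def ring_of_type_algebra_sel)
  then show ?thesis
    by unfold_locales (simp_all add: mult_mat2_monoid_type one_mat2_monoid_type matrix_mul_assoc)
qed

lemma group_GL2: "group (GL2 (ring_of_type_algebra :: 'a::comm_ring_1 ring))"
  unfolding GL2_def by (rule monoid.units_group[OF monoid_mat2])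

lemma mult_GL2: "A \<otimes>\<^bsub>GL2 ring_of_type_algebra\<^esub> B = A ** (B :: 'a::comm_ring_1^2^2)"
  by (simp add: GL2_def units_of_mult mult_mat2_monoid_type)

lemma one_GL2: "\<one>\<^bsub>GL2 ring_of_type_algebra\<^esub> = (mat 1 :: 'a::comm_ring_1^2^2)"
  by (simp add: GL2_def units_of_one one_mat2_monoid_type)

lemma GL2_inverse:
  fixes A :: "'a::comm_ring_1^2^2"
  assumes "A \<in> carrier (GL2 ring_of_type_algebra)"
  shows "inv\<^bsub>GL2 ring_of_type_algebra\<^esub> A ** A = mat 1"
    "A ** inv\<^bsub>GL2 ring_of_type_algebra\<^esub> A = mat 1"
  using group.l_inv[OF group_GL2 assms] group.r_inv[OF group_GL2 assms]
  by (simp_all add: mult_GL2 one_GL2)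

text \<open>Allows commutation modulo \<open>(a, b)^n\<close> to be checked on generators
  only.\<close>

lemma subgroup_mat_centralizer:
  fixes B :: "'a::comm_ring_1^2^2"
  shows "subgroup {A \<in> carrier (GL2 ring_of_type_algebra). mat_cong a b n (A ** B) (B ** A)}
    (GL2 ring_of_type_algebra)" (is "subgroup ?C ?G")
proof -
  interpret group "?G" by (rule group_GL2)
  show ?thesis
  proof (rule subgroupI)
    show "?C \<noteq> {}"
      using one_closed by (auto simp: one_GL2 mat_cong_refl)
  next
    fix A assume "A \<in> ?C"
    then have A: "A \<in> carrier ?G" and c: "mat_cong a b n (A ** B) (B ** A)" by auto
    let ?A' = "inv\<^bsub>?G\<^esub> A"
    note inv = GL2_inverse[OF A]
    \<comment> \<open>Multiplying \<open>AB \<equiv> BA\<close> by the inverse of \<open>A\<close>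
      on both sides moves that inverse across \<open>B\<close>.\<close>
    have "mat_cong a b n (?A' ** (A ** B) ** ?A') (?A' ** (B ** A) ** ?A')"
      by (intro mat_cong_mult_left mat_cong_mult_right c)
    moreover have "?A' ** (A ** B) ** ?A' = B ** ?A'"
      by (simp add: matrix_mul_assoc inv)
    moreover have "?A' ** (B ** A) ** ?A' = ?A' ** B"
      by (simp add: matrix_mul_assoc[symmetric] inv)
    ultimately show "?A' \<in> ?C"
      using A mat_cong_sym by auto
  next
    fix A D assume "A \<in> ?C" "D \<in> ?C"
    then have A: "A \<in> carrier ?G" "D \<in> carrier ?G"
      and c: "mat_cong a b n (A ** B) (B ** A)" "mat_cong a b n (D ** B) (B ** D)" by auto
    \<comment> \<open>\<open>B\<close> is moved to the left in two stages, first past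
      \<open>D\<close> and then past \<open>A\<close>.\<close>
    have "mat_cong a b n (A ** (D ** B)) (A ** (B ** D))"
      by (intro mat_cong_mult_left c)
    moreover have "mat_cong a b n ((A ** B) ** D) ((B ** A) ** D)"
      by (intro mat_cong_mult_right c)
    ultimately have "mat_cong a b n ((A ** D) ** B) (B ** (A ** D))"
      by (metis matrix_mul_assoc mat_cong_trans)
    then show "A \<otimes>\<^bsub>?G\<^esub> D \<in> ?C"
      using A m_closed by (auto simp: mult_GL2)
  qed auto
qed

text \<open>This is the principal congruence subgroup of level \<open>(a, b)^n\<close>.\<close>

lemma subgroup_congruence:
  "subgroup {A \<in> carrier (GL2 ring_of_type_algebra). mat_cong a b n A (mat 1)}
    (GL2 (ring_of_type_algebra :: 'a::comm_ring_1 ring))" (is "subgroup ?C ?G")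
proof -
  interpret group "?G" by (rule group_GL2)
  show ?thesis
  proof (rule subgroupI)
    show "?C \<noteq> {}"
      using one_closed by (auto simp: one_GL2 mat_cong_refl)
  next
    fix A assume "A \<in> ?C"
    then have A: "A \<in> carrier ?G" and c: "mat_cong a b n A (mat 1)" by auto
    show "inv\<^bsub>?G\<^esub> A \<in> ?C"
      using mat_cong_sym[OF mat_cong_mult_left[OF c, of "inv\<^bsub>?G\<^esub> A"]] A
      by (simp add: GL2_inverse)
  next
    fix A D assume "A \<in> ?C" "D \<in> ?C"
    then have A: "A \<in> carrier ?G" "D \<in> carrier ?G"
      and c: "mat_cong a b n A (mat 1)" "mat_cong a b n D (mat 1)" by auto
    have "mat_cong a b n (A ** D) (mat 1)"
      using mat_cong_trans[OF mat_cong_mult_right[OF c(1), of D]] c(2) by simp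
    then show "A \<otimes>\<^bsub>?G\<^esub> D \<in> ?C"
      using A m_closed by (auto simp: mult_GL2)
  qed auto
qed

section \<open>The derived series of \<open>F_group\<close>\<close>

lemma group_F_group: "group F_group"
  unfolding F_group_def by (rule group.group_subgroup_generated[OF group_GL2])

lemma F_group_subset_GL2: "carrier F_group \<subseteq> carrier (GL2 R_xyt)"
  unfolding F_group_def by (rule group.carrier_subgroup_generated_subset[OF group_GL2])

lemma F_group_minimal:
  assumes "subgroup H (GL2 R_xyt)" "M1 \<in> H" "M2 ** T_mat \<in> H"
  shows "carrier F_group \<subseteq> H"
  unfolding F_group_def using assms by (intro group.subgroup_generated_minimal[OF group_GL2]) auto

abbreviation F_cong :: "nat \<Rightarrow> laurent_xyt^2^2 \<Rightarrow> laurent_xyt^2^2 \<Rightarrow> bool" where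
  "F_cong \<equiv> mat_cong (var_x - 1) (var_y - 1)"

lemma M1_cong: "F_cong 1 M1 (mat 1)"
  using pow_ideal_gens(1)[of 1 "var_x - 1" "var_y - 1"]
    pow_ideal_gens(2)[of "-1" "var_y - 1" "var_x - 1"]
  by (simp add: mat_cong_def M1_def mat_def forall_2 pow_ideal.zero)

text \<open>Modulo \<open>(x - 1, y - 1)\<close> only the generator \<open>M2 ** T_mat\<close>
  survives, so the group becomes cyclic there.\<close>

lemma F_group_commute:
  assumes "A \<in> carrier F_group" "B \<in> carrier F_group"
  shows "F_cong 1 (A ** B) (B ** A)"
proof -
  have M1: "F_cong 1 (M1 ** B) (B ** M1)" for B
    using mat_cong_mult_right[OF M1_cong, of B] mat_cong_mult_left[OF M1_cong, of B]
    by (auto intro: mat_cong_trans mat_cong_sym)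
  \<comment> \<open>Since \<open>M1\<close> commutes with every \<open>B\<close>, the centralizer of
    \<open>B\<close> contains the whole group as soon as it contains the second generator.\<close>
  have comm: "F_cong 1 (A ** B) (B ** A)"
    if "A \<in> carrier F_group" "F_cong 1 ((M2 ** T_mat) ** B) (B ** (M2 ** T_mat))" for A B
    using F_group_minimal[OF subgroup_mat_centralizer] that M1 generators_in_GL2 by blast
  \<comment> \<open>The second generator commutes with itself, so all of the group commutes with it;
    a second use of \<open>comm\<close> then allows arbitrary pairs.\<close>
  have "F_cong 1 (B ** (M2 ** T_mat)) ((M2 ** T_mat) ** B)"
    using comm[OF assms(2)] mat_cong_refl by blast
  then show ?thesis
    using comm[OF assms(1)] mat_cong_sym by blast
qed

definition F_filtration :: "nat \<Rightarrow> (laurent_xyt^2^2) set" where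
  "F_filtration n = {A \<in> carrier F_group. F_cong n A (mat 1)}"

lemma F_filtration_subgroup: "subgroup (F_filtration n) F_group"
proof -
  interpret group "GL2 R_xyt" by (rule group_GL2)
  have eq: "F_filtration n
      = carrier F_group \<inter> {A \<in> carrier (GL2 R_xyt). F_cong n A (mat 1)}"
    using F_group_subset_GL2 by (auto simp: F_filtration_def)
  have "subgroup (F_filtration n) (GL2 R_xyt)"
    unfolding eq by (intro subgroups_Inter_pair subgroup_congruence)
      (simp add: F_group_def subgroup_subgroup_generated)
  then show ?thesis
    unfolding F_group_def subgroup_subgroup_generated_iff
    by (auto simp: F_filtration_def F_group_def)
qed

text \<open>Commutators generate the derived subgroup, so it suffices to place each of them in the
  subgroup \<open>F_filtration n\<close>. This serves both the first derivation and the later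
  doubling steps.\<close>

lemma derived_F_group_subset:
  assumes "H \<subseteq> carrier F_group"
    and comm: "\<And>A B. A \<in> H \<Longrightarrow> B \<in> H \<Longrightarrow> F_cong n (A ** B) (B ** A)"
  shows "derived F_group H \<subseteq> F_filtration n"
proof -
  interpret F: group F_group by (rule group_F_group)
  have mult: "A \<otimes>\<^bsub>F_group\<^esub> B = A ** B" for A B
    by (simp add: F_group_def mult_GL2)
  have inv: "A ** inv\<^bsub>F_group\<^esub> A = mat 1" if "A \<in> H" for A
    using F.r_inv[of A] that assms(1) by (auto simp: F_group_def mult_GL2 one_GL2)
  have "A \<otimes>\<^bsub>F_group\<^esub> B \<otimes>\<^bsub>F_group\<^esub> inv\<^bsub>F_group\<^esub> A \<otimes>\<^bsub>F_group\<^esub> inv\<^bsub>F_group\<^esub> B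
      \<in> F_filtration n" if "A \<in> H" "B \<in> H" for A B
  proof -
    have "A \<otimes>\<^bsub>F_group\<^esub> B \<otimes>\<^bsub>F_group\<^esub> inv\<^bsub>F_group\<^esub> A \<otimes>\<^bsub>F_group\<^esub> inv\<^bsub>F_group\<^esub> B
        \<in> carrier F_group"
      using that assms(1) by (intro F.m_closed F.inv_closed) auto
    then show ?thesis
      using mat_cong_commutator[OF comm[OF that] inv[OF that(1)] inv[OF that(2)]]
      by (simp add: F_filtration_def mult)
  qed
  then show ?thesis
    unfolding derived_def by (intro F.generate_subgroup_incl F_filtration_subgroup) auto
qed

text \<open>The first derivation reaches level \<open>1 = 2 ^ 0\<close> by commutativity modulo the
  ideal; each further one doubles the level.\<close>

lemma derived_series_F_group:
  "(derived F_group ^^ Suc n) (carrier F_group) \<subseteq> F_filtration (2 ^ n)"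
proof (induction n)
  case 0
  then show ?case using F_group_commute by (simp add: derived_F_group_subset)
next
  case (Suc n)
  interpret F: group F_group by (rule group_F_group)
  have "(derived F_group ^^ Suc (Suc n)) (carrier F_group)
      \<subseteq> derived F_group (F_filtration (2 ^ n))"
    using F.mono_derived[OF Suc] by simp
  also have "\<dots> \<subseteq> F_filtration (2 ^ n + 2 ^ n)"
    by (intro derived_F_group_subset) (auto simp: F_filtration_def intro: mat_cong_one_commute)
  finally show ?case by (simp add: mult_2)
qed

section \<open>Reduction modulo \<open>J\<close> and solvability of \<open>G\<close>\<close>

lemma reduce_mod_eq:
  fixes A B :: "laurent_xyt^2^2"
  assumes J: "ideal J R_xyt" and "\<And>i j. (A - B) $ i $ j \<in> J"
  shows "reduce_mod J A = reduce_mod J B"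
proof -
  interpret ideal J R_xyt by (rule J)
  have "J +>\<^bsub>R_xyt\<^esub> (A $ i $ j) = J +>\<^bsub>R_xyt\<^esub> (B $ i $ j)" for i j
  proof (rule a_repr_independence'[symmetric])
    have "A $ i $ j = (A - B) $ i $ j + B $ i $ j" by simp
    then show "A $ i $ j \<in> J +>\<^bsub>R_xyt\<^esub> B $ i $ j"
      using assms(2)[of i j] unfolding a_r_coset_def' ring_of_type_algebra_sel by blast
  qed (simp add: ring_of_type_algebra_sel)
  then show ?thesis by (simp add: reduce_mod_def)
qed

theorem proposition2:
  fixes p e q :: nat
    and G :: "('g, 'm) monoid_scheme"
    and \<gamma> :: "laurent_xyt^2^2 \<Rightarrow> 'g"
  assumes "Factorial_Ring.prime p" and "e \<ge> 1" and "q = p ^ e"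
    and "group G"
    and "\<gamma> \<in> epi F_group G"
    and "sends_R_into_S q G \<gamma>"
  shows "solvable G"
proof -
  interpret F: group F_group by (rule group_F_group)
  interpret G: group G by (rule assms(4))
  interpret h: group_hom F_group G \<gamma>
    using assms(5) by unfold_locales (simp add: epi_def)
  have surj: "\<gamma> ` carrier F_group = carrier G"
    using assms(5) by (simp add: epi_def)
  obtain J \<phi> where J: "ideal J R_xyt"
    and sub: "const_t ` (cyclotomic_ideal q \<cdot>\<^bsub>R_xy\<^esub> augmentation_ideal) \<subseteq> J"
    and iso: "\<phi> \<in> iso G ((GL2 (R_xyt Quot J)) \<lparr> carrier := reduce_mod J ` carrier F_group \<rparr>)"
    and red: "\<And>A. A \<in> carrier F_group \<Longrightarrow> \<phi> (\<gamma> A) = reduce_mod J A"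
    using assms(6) unfolding sends_R_into_S_def by blast
  \<comment> \<open>\<open>Suc (q * e)\<close> is the exponent that puts the powers of
    \<open>x - 1\<close> and of \<open>y - 1\<close> into \<open>J\<close>; the factor
    \<open>2\<close> is the one from \<open>pow_ideal_subset\<close>.\<close>
  define N where "N = 2 * Suc (q * e)"
  have "pow_ideal (var_x - 1) (var_y - 1) N \<subseteq> J"
    unfolding N_def var_x_def var_y_def
    using pos_unit_diff_power_mem[OF assms(1,3) sub] ideal_ring_of_type_algebraD[OF J]
    by (intro pow_ideal_subset)
  \<comment> \<open>A crude bound: level \<open>2 ^ N\<close>, reached after \<open>Suc N\<close>
    derivations, already lies beyond \<open>N\<close>.\<close>
  moreover have "N \<le> 2 ^ N"
    by (simp add: less_imp_le)
  ultimately have NJ: "pow_ideal (var_x - 1) (var_y - 1) (2 ^ N) \<subseteq> J"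
    using pow_ideal_antimono by blast
  have trivial: "\<gamma> A = \<one>\<^bsub>G\<^esub>" if "A \<in> F_filtration (2 ^ N)" for A
  proof -
    have A: "A \<in> carrier F_group" and c: "F_cong (2 ^ N) A (mat 1)"
      using that by (auto simp: F_filtration_def)
    have one: "\<one>\<^bsub>F_group\<^esub> = mat 1" by (simp add: F_group_def one_GL2)
    \<comment> \<open>\<open>A\<close> and the identity have the same reduction modulo
      \<open>J\<close>, so injectivity of \<open>\<phi>\<close> gives them the same image under
      \<open>\<gamma>\<close>.\<close>
    have "reduce_mod J A = reduce_mod J \<one>\<^bsub>F_group\<^esub>"
      unfolding one using c NJ by (intro reduce_mod_eq[OF J]) (auto simp: mat_cong_def)
    then have "\<phi> (\<gamma> A) = \<phi> (\<gamma> \<one>\<^bsub>F_group\<^esub>)"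
      by (simp only: red[OF A] red[OF F.one_closed])
    then have "\<gamma> A = \<gamma> \<one>\<^bsub>F_group\<^esub>"
      using iso A by (auto simp: iso_iff dest: inj_onD)
    then show ?thesis by simp
  qed
  \<comment> \<open>A surjective homomorphism maps the derived series of its source onto that of its
    target.\<close>
  have "(derived G ^^ Suc N) (carrier G) = \<gamma> ` (derived F_group ^^ Suc N) (carrier F_group)"
    using h.exp_of_derived_img[of "carrier F_group" "Suc N"] surj by simp
  also have "\<dots> \<subseteq> {\<one>\<^bsub>G\<^esub>}"
    using derived_series_F_group[of N] trivial by blast
  finally have "(derived G ^^ Suc N) (carrier G) = {\<one>\<^bsub>G\<^esub>}"
    using subgroup.one_closed[OF G.exp_of_derived_is_subgroup[OF G.subgroup_self], of "Suc N"]
    by blast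
  then show ?thesis
    unfolding G.solvable_iff_trivial_derived_seq by blast
qed

end
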